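(* (a) Let $n\ge 1$ and let $X_1,\ldots,X_k$ be pairwise disjoint finite sets with $|X_i|\le n$ for $i=1,\ldots,k$, and let $X=\bigcup_{i=1}^k X_i$. If $\mathcal F\subseteq 2^X$ satisfies $|\mathcal F|>2^{|X|-1}$, then there is a subfamily $\mathcal G\subseteq\mathcal F$ with $|\mathcal G|\le\lceil\log_2 n\rceil+1$ such that for every $i=1,\ldots,k$, every pair of distinct elements of $X_i$ is separated by some member of $\mathcal G$. (b) The bound is tight: for every integer $n\ge 2$ there exist $k$, pairwise disjoint sets $X_1,\ldots,X_k$ with $|X_i|\le n$, and a family $\mathcal F\subseteq 2^X$ (where $X=\bigcup_i X_i$) with $|\mathcal F|>2^{|X|-1}$, such that no subfamily of $\mathcal F$ of cardinality at most $\lceil\log_2 n\rceil$ separates every pair of distinct elements of $X_i$ for all $i=1,\ldots,k$ simultaneously.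
   Context: A set $F$ separates two elements $x,y$ if it contains exactly one of them; a family separates a pair if at least one of its members separates it. *)

theory Defs
  imports Complex_Main "HOL-Library.Disjoint_Sets"
begin

definition separates :: "'a set \<Rightarrow> 'a \<Rightarrow> 'a \<Rightarrow> bool" where
  "separates A x y \<longleftrightarrow> (x \<in> A) \<noteq> (y \<in> A)"

definition family_separates :: "'a set set \<Rightarrow> 'a \<Rightarrow> 'a \<Rightarrow> bool" where
  "family_separates G x y \<longleftrightarrow> (\<exists>A\<in>G. separates A x y)"

definition separates_within :: "'a set set \<Rightarrow> nat \<Rightarrow> (nat \<Rightarrow> 'a set) \<Rightarrow> bool" where
  "separates_within G k X \<longleftrightarrow>
    (\<forall>i\<in>{1..k}. \<forall>x\<in>X i. \<forall>y\<in>X i. x \<noteq> y \<longrightarrow> family_separates G x y)"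

(* The exponent card X - 1 is taken in the integers, so that it is -1 for the empty ground set. *)
definition more_than_half :: "'a set set \<Rightarrow> 'a set \<Rightarrow> bool" where
  "more_than_half F X \<longleftrightarrow> real (card F) > 2 powi (int (card X) - 1)"

end

theory Submission
  imports Defs
begin

text \<open>
  (a) Give the elements of each \<open>X i\<close> distinct codes, subsets of a set \<open>U\<close> of size
  \<open>m = \<lceil>log 2 n\<rceil>\<close>. The sets \<open>{x. odd (card (D \<inter> c x))}\<close>, for \<open>D \<subseteq> U\<close>, form a linear image of
  \<open>GF(2)\<^sup>m\<close> that separates within each \<open>X i\<close>. By averaging, some translate of it meets
  the family in more than half of the parameters \<open>D\<close>; these parameters affinely span \<open>GF(2)\<^sup>m\<close>,
  since a proper affine subspace contains at most half of the points. Hence \<open>m + 1\<close> of them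
  already span, and the corresponding members of the family separate.

  (b) Take many blocks of size \<open>n\<close> and let the family consist of the sets that are trivial (empty or
  full) on at least one block. If \<open>\<lceil>log 2 n\<rceil>\<close> members separated, one could delete a member that
  is trivial on some block and still separate that block with too few sets.
\<close>

section \<open>Parities of intersections as linear functionals over GF(2)\<close>

lemma double_card_le_if_inj_into_complement:
  assumes "finite V" "K \<subseteq> V" "inj_on f K" "f ` K \<subseteq> V - K"
  shows "2 * card K \<le> card V"
proof -
  have "card K \<le> card (V - K)"
    using assms by (metis card_image card_mono finite_Diff)
  moreover have "card (V - K) = card V - card K" "card K \<le> card V"
    using assms by (auto simp: card_Diff_subset finite_subset card_mono)
  ultimately show ?thesis by linarith
qed

lemma inj_on_sym_diff: "inj_on (\<lambda>A. sym_diff A B) S"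
  by (rule inj_onI) blast

lemma odd_card_sym_diff:
  assumes "finite A" "finite B"
  shows "odd (card (sym_diff A B)) \<longleftrightarrow> odd (card A) \<noteq> odd (card B)"
proof -
  have "card (sym_diff A B) = card (A - B) + card (B - A)"
    using assms by (intro card_Un_disjoint) auto
  moreover have "card A = card (A - B) + card (A \<inter> B)"
    using assms by (subst card_Un_disjoint [symmetric]) (auto intro: arg_cong[where f = card])
  moreover have "card B = card (B - A) + card (A \<inter> B)"
    using assms by (subst card_Un_disjoint [symmetric]) (auto intro: arg_cong[where f = card])
  ultimately show ?thesis by presburger
qed

lemma odd_card_Int_sym_diff:
  assumes "finite A" "finite B"
  shows "odd (card (D \<inter> sym_diff A B)) \<longleftrightarrow> odd (card (D \<inter> A)) \<noteq> odd (card (D \<inter> B))"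
proof -
  have "D \<inter> sym_diff A B = sym_diff (D \<inter> A) (D \<inter> B)" by blast
  then show ?thesis using odd_card_sym_diff[of "D \<inter> A" "D \<inter> B"] assms by simp
qed

text \<open>Toggling a fixed \<open>j\<close> in \<open>J\<close> flips the parity of
  \<open>D \<inter> J\<close>, so it maps the class injectively into its complement: an affine
  hyperplane holds at most half of the points.\<close>

lemma double_card_parity_class_le:
  assumes "finite U" "J \<subseteq> U" "J \<noteq> {}"
  shows "2 * card {D \<in> Pow U. odd (card (D \<inter> J)) = b} \<le> 2 ^ card U"
proof -
  from assms obtain j where j: "j \<in> J" by blast
  let ?K = "{D \<in> Pow U. odd (card (D \<inter> J)) = b}"
  have flip: "odd (card (sym_diff D {j} \<inter> J)) \<longleftrightarrow> \<not> odd (card (D \<inter> J))" if "D \<subseteq> U" for D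
  proof -
    have "finite D" using that assms(1) finite_subset by blast
    moreover have "J \<inter> {j} = {j}" using j by blast
    ultimately show ?thesis using odd_card_Int_sym_diff[of D "{j}" J]
      by (simp add: Int_commute)
  qed
  have "2 * card ?K \<le> card (Pow U)"
  proof (rule double_card_le_if_inj_into_complement[OF _ _ inj_on_sym_diff[of "{j}"]])
    show "(\<lambda>A. sym_diff A {j}) ` ?K \<subseteq> Pow U - ?K"
    proof (rule image_subsetI)
      fix D assume "D \<in> ?K"
      then have D: "D \<subseteq> U" "odd (card (D \<inter> J)) = b" by auto
      moreover have "sym_diff D {j} \<subseteq> U" using D j assms by blast
      ultimately show "sym_diff D {j} \<in> Pow U - ?K" using flip[of D] by blast
    qed
  qed (use assms in auto)
  then show ?thesis using assms by (simp add: card_Pow)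
qed

text \<open>A subset \<open>J\<close> stands for the linear functional sending \<open>D\<close> to
  the parity of \<open>D \<inter> J\<close>. The set is thus the annihilator of all differences of
  members of \<open>T\<close>; for nonempty \<open>T\<close>, it is trivial exactly when
  \<open>T\<close> affinely spans \<open>Pow U\<close>.\<close>

definition constant_parities :: "'a set \<Rightarrow> 'a set set \<Rightarrow> 'a set set" where
  "constant_parities U T =
    {J \<in> Pow U. \<forall>D\<in>T. \<forall>D'\<in>T. odd (card (D \<inter> J)) = odd (card (D' \<inter> J))}"

text \<open>Adding \<open>J\<close> preserves constancy on \<open>T\<close>, but destroys agreement
  between \<open>s\<close> and \<open>D\<close>. So the smaller annihilator has a translate disjoint
  from itself inside the larger one.\<close>

lemma double_card_constant_parities_insert_le:
  assumes U: "finite U" and J: "J \<in> constant_parities U T"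
    and D: "D \<in> T" "odd (card (s \<inter> J)) \<noteq> odd (card (D \<inter> J))"
  shows "2 * card (constant_parities U (insert s T)) \<le> card (constant_parities U T)"
proof (rule double_card_le_if_inj_into_complement[OF _ _ inj_on_sym_diff[of J]])
  show "finite (constant_parities U T)" using U by (auto simp: constant_parities_def)
  show "constant_parities U (insert s T) \<subseteq> constant_parities U T"
    by (auto simp: constant_parities_def)
  show "(\<lambda>A. sym_diff A J) ` constant_parities U (insert s T)
    \<subseteq> constant_parities U T - constant_parities U (insert s T)"
  proof (rule image_subsetI)
    fix I assume I: "I \<in> constant_parities U (insert s T)"
    have JU: "J \<subseteq> U" and IU: "I \<subseteq> U" using J I by (auto simp: constant_parities_def)
    then have odd_iff: "odd (card (E \<inter> sym_diff I J)) \<longleftrightarrow> odd (card (E \<inter> I)) \<noteq> odd (card (E \<inter> J))" for E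
      using odd_card_Int_sym_diff U finite_subset by metis
    have sub: "sym_diff I J \<subseteq> U" using IU JU by blast
    have Ic: "odd (card (E \<inter> I)) = odd (card (E' \<inter> I))" if "E \<in> insert s T" "E' \<in> insert s T" for E E'
      using I that unfolding constant_parities_def by blast
    have Jc: "odd (card (E \<inter> J)) = odd (card (E' \<inter> J))" if "E \<in> T" "E' \<in> T" for E E'
      using J that unfolding constant_parities_def by blast
    have "sym_diff I J \<in> constant_parities U T"
      unfolding constant_parities_def mem_Collect_eq odd_iff
      using sub Ic Jc by (metis (no_types, lifting) PowI insertI2)
    moreover have "sym_diff I J \<notin> constant_parities U (insert s T)"
      unfolding constant_parities_def mem_Collect_eq odd_iff
      using D Ic by (metis (no_types, lifting) insertI1 insertI2)
    ultimately show "sym_diff I J \<in> constant_parities U T - constant_parities U (insert s T)" by blast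
  qed
qed

text \<open>Each greedily added vector halves the space of functionals that are constant on the chosen
  ones.\<close>

lemma obtain_affinely_spanning_subset:
  assumes U: "finite U" and S: "S \<subseteq> Pow U" "2 ^ card U < 2 * card S"
  obtains T where "T \<subseteq> S" "card T \<le> card U + 1" "constant_parities U T = {{}}"
proof -
  \<comment> \<open>The first alternative covers the case that the chosen vectors span early, when
    no further halving is possible.\<close>
  have "\<exists>T\<subseteq>S. T \<noteq> {} \<and> finite T \<and> card T \<le> t + 1 \<and>
      (constant_parities U T = {{}} \<or> card (constant_parities U T) * 2 ^ t \<le> 2 ^ card U)" for t
  proof (induction t)
    case 0
    obtain s where "s \<in> S" using S by fastforce
    moreover have "card (constant_parities U {s}) \<le> 2 ^ card U"
      using U card_mono[of "Pow U" "constant_parities U {s}"]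
      by (auto simp: constant_parities_def card_Pow)
    ultimately show ?case by (intro exI[of _ "{s}"]) auto
  next
    case (Suc t)
    then obtain T where T: "T \<subseteq> S" "T \<noteq> {}" "finite T" "card T \<le> t + 1"
      and bound: "constant_parities U T = {{}} \<or> card (constant_parities U T) * 2 ^ t \<le> 2 ^ card U"
      by blast
    show ?case
    proof (cases "constant_parities U T = {{}}")
      case True
      with T show ?thesis by (intro exI[of _ T]) simp
    next
      case False
      moreover have "{} \<in> constant_parities U T" by (simp add: constant_parities_def)
      ultimately have "\<not> constant_parities U T \<subseteq> {{}}" by (metis empty_iff subset_singletonD)
      then obtain J where J: "J \<in> constant_parities U T" "J \<noteq> {}" by blast
      then have JU: "J \<subseteq> U" by (auto simp: constant_parities_def)
      obtain D where D: "D \<in> T" using T by blast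
      \<comment> \<open>Otherwise \<open>S\<close> would lie in an affine hyperplane, which is too
        small to hold more than half of \<open>Pow U\<close>.\<close>
      have "\<exists>s\<in>S. odd (card (s \<inter> J)) \<noteq> odd (card (D \<inter> J))"
      proof (rule ccontr)
        assume "\<not> ?thesis"
        then have "S \<subseteq> {E \<in> Pow U. odd (card (E \<inter> J)) = odd (card (D \<inter> J))}"
          using S by blast
        then have "card S \<le> card {E \<in> Pow U. odd (card (E \<inter> J)) = odd (card (D \<inter> J))}"
          using U by (intro card_mono) auto
        then show False
          using S double_card_parity_class_le[OF U JU J(2), of "odd (card (D \<inter> J))"] by linarith
      qed
      then obtain s where s: "s \<in> S" "odd (card (s \<inter> J)) \<noteq> odd (card (D \<inter> J))" by blast
      have "card (constant_parities U (insert s T)) * 2 ^ Suc t \<le> card (constant_parities U T) * 2 ^ t"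
        using double_card_constant_parities_insert_le[OF U J(1) D s(2)] by simp
      then have "card (constant_parities U (insert s T)) * 2 ^ Suc t \<le> 2 ^ card U"
        using bound False by linarith
      moreover have "card (insert s T) \<le> Suc t + 1"
        using T card_insert_le_m1[of "Suc t + 1" T s] by simp
      ultimately show ?thesis using T s by (intro exI[of _ "insert s T"]) auto
    qed
  qed
  \<comment> \<open>After \<open>card U\<close> halvings at most one functional is left, and the
    zero functional \<open>{}\<close> always remains.\<close>
  from this[of "card U"] obtain T where T: "T \<subseteq> S" "card T \<le> card U + 1"
    and "constant_parities U T = {{}} \<or> card (constant_parities U T) \<le> 1" by auto
  moreover have "{} \<in> constant_parities U T" "finite (constant_parities U T)"
    using U by (auto simp: constant_parities_def)
  ultimately have "constant_parities U T = {{}}"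
    using card_le_Suc0_iff_eq[of "constant_parities U T"] by (simp only: One_nat_def) blast
  with T that show thesis by blast
qed

section \<open>Averaging over translates, and the upper bound\<close>

text \<open>Double counting of pairs \<open>(B, D)\<close>: each \<open>D\<close> is hit by exactly
  \<open>card F\<close> sets \<open>B\<close>, as translation by \<open>A D\<close> is an involution
  of \<open>Pow X\<close>. The count runs over parameters, so different \<open>D\<close> with equal
  \<open>A D\<close> count separately.\<close>

lemma obtain_translate_with_large_intersection:
  assumes X: "finite X" and F: "F \<subseteq> Pow X" "2 ^ card X < 2 * card F"
    and P: "finite P" "P \<noteq> {}" "\<And>D. D \<in> P \<Longrightarrow> A D \<subseteq> X"
  obtains B where "B \<subseteq> X" "card P < 2 * card {D \<in> P. sym_diff B (A D) \<in> F}"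
proof -
  have translate: "card {B \<in> Pow X. sym_diff B (A D) \<in> F} = card F" if "D \<in> P" for D
  proof (rule bij_betw_same_card[of "\<lambda>B. sym_diff B (A D)"])
    have cancel: "sym_diff (sym_diff B (A D)) (A D) = B" for B by blast
    have "sym_diff B (A D) \<subseteq> X" if "B \<in> F" for B using that F P(3)[OF \<open>D \<in> P\<close>] by blast
    then show "bij_betw (\<lambda>B. sym_diff B (A D)) {B \<in> Pow X. sym_diff B (A D) \<in> F} F"
      by (intro bij_betw_byWitness[where f' = "\<lambda>B. sym_diff B (A D)"])
        (simp_all only: cancel image_subset_iff, simp_all add: cancel)
  qed
  have "(\<Sum>B\<in>Pow X. card {D \<in> P. sym_diff B (A D) \<in> F})
      = (\<Sum>D\<in>P. card {B \<in> Pow X. sym_diff B (A D) \<in> F})"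
    using X P by (intro sum_multicount_gen) auto
  also have "\<dots> = card P * card F" using translate by simp
  finally have total: "(\<Sum>B\<in>Pow X. 2 * card {D \<in> P. sym_diff B (A D) \<in> F}) = card P * (2 * card F)"
    by (simp flip: sum_distrib_left)
  have "\<exists>B\<subseteq>X. card P < 2 * card {D \<in> P. sym_diff B (A D) \<in> F}"
  proof (rule ccontr)
    assume "\<not> ?thesis"
    then have "(\<Sum>B\<in>Pow X. 2 * card {D \<in> P. sym_diff B (A D) \<in> F}) \<le> (\<Sum>B\<in>Pow X. card P)"
      by (intro sum_mono) auto
    also have "\<dots> = card P * 2 ^ card X" using X by (simp add: card_Pow)
    also have "\<dots> < card P * (2 * card F)" using F P by (simp add: card_gt_0_iff)
    finally show False using total by simp
  qed
  with that show thesis by blast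
qed

lemma more_than_half_iff: "more_than_half F X \<longleftrightarrow> 2 ^ card X < 2 * card F"
proof -
  have "(2::real) powi (int (card X) - 1) = 2 ^ card X / 2"
    by (simp add: power_int_diff)
  then have "more_than_half F X \<longleftrightarrow> real (2 ^ card X) < real (2 * card F)"
    unfolding more_than_half_def by (simp only: of_nat_mult of_nat_power of_nat_numeral) linarith
  then show ?thesis by (simp only: of_nat_less_iff)
qed

lemma separating_subfamily_exists:
  assumes disj: "disjoint_family_on X {1..k}"
    and X: "\<forall>i\<in>{1..k}. finite (X i) \<and> card (X i) \<le> 2 ^ m"
    and F: "F \<subseteq> Pow (\<Union>i\<in>{1..k}. X i)" "more_than_half F (\<Union>i\<in>{1..k}. X i)"
  shows "\<exists>G\<subseteq>F. card G \<le> m + 1 \<and> separates_within G k X"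
proof -
  define U where "U = {..<m}"
  let ?X = "\<Union>i\<in>{1..k}. X i"
  have U: "finite U" "card U = m" by (simp_all add: U_def)
  \<comment> \<open>Codes are distinct only within a block; different blocks may share them.\<close>
  have "\<exists>c. inj_on c (X i) \<and> c ` X i \<subseteq> Pow U" if "i \<in> {1..k}" for i
    using that X U inj_on_iff_card_le[of "X i" "Pow U"] by (auto simp: card_Pow)
  then obtain c where c: "\<And>i. i \<in> {1..k} \<Longrightarrow> inj_on (c i) (X i) \<and> c i ` X i \<subseteq> Pow U" by metis
  define A where "A D = {x \<in> ?X. \<exists>i\<in>{1..k}. x \<in> X i \<and> odd (card (D \<inter> c i x))}" for D
  \<comment> \<open>By disjointness the block of \<open>x\<close> is unique, so its code is well
    defined and \<open>A\<close> is linear in \<open>D\<close>.\<close>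
  have A_iff: "x \<in> A D \<longleftrightarrow> odd (card (D \<inter> c i x))" if "i \<in> {1..k}" "x \<in> X i" for x i D
  proof -
    have "j = i" if "j \<in> {1..k}" "x \<in> X j" for j
      using that \<open>i \<in> {1..k}\<close> \<open>x \<in> X i\<close> disj unfolding disjoint_family_on_def by blast
    then show ?thesis using that unfolding A_def by blast
  qed
  obtain B where B: "B \<subseteq> ?X" "card (Pow U) < 2 * card {D \<in> Pow U. sym_diff B (A D) \<in> F}"
  proof (rule obtain_translate_with_large_intersection[of ?X F "Pow U" A])
    show "finite ?X" using X by auto
    show "2 ^ card ?X < 2 * card F" using F more_than_half_iff by blast
  qed (use F U in \<open>auto simp: A_def\<close>)
  obtain T where T: "T \<subseteq> {D \<in> Pow U. sym_diff B (A D) \<in> F}" "card T \<le> card U + 1"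
    and spanning: "constant_parities U T = {{}}"
    by (rule obtain_affinely_spanning_subset[of U "{D \<in> Pow U. sym_diff B (A D) \<in> F}"])
      (use B U in \<open>auto simp: card_Pow\<close>)
  have "finite T" using T U by (auto intro: finite_subset)
  define G where "G = (\<lambda>D. sym_diff B (A D)) ` T"
  have "G \<subseteq> F" using T by (auto simp: G_def)
  moreover have "card G \<le> m + 1"
    using card_image_le[OF \<open>finite T\<close>] T U unfolding G_def by (metis le_trans)
  moreover have "separates_within G k X"
    unfolding separates_within_def
  proof (intro ballI impI)
    fix i x y assume i: "i \<in> {1..k}" and xy: "x \<in> X i" "y \<in> X i" "x \<noteq> y"
    let ?J = "sym_diff (c i x) (c i y)"
    have sub: "c i x \<subseteq> U" "c i y \<subseteq> U" using c[OF i] xy by auto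
    have "c i x \<noteq> c i y" using c[OF i] xy by (auto dest: inj_onD)
    then have "?J \<noteq> {}" by blast
    then have "?J \<notin> constant_parities U T" using spanning by simp
    moreover have "?J \<subseteq> U" using sub by blast
    ultimately obtain D D' where D: "D \<in> T" "D' \<in> T" "odd (card (D \<inter> ?J)) \<noteq> odd (card (D' \<inter> ?J))"
      unfolding constant_parities_def by blast
    have fin: "finite (c i x)" "finite (c i y)" using sub U finite_subset by blast+
    \<comment> \<open>Separation of \<open>x\<close> and \<open>y\<close> is an affine function of
      \<open>E\<close> whose linear part is the functional \<open>?J\<close>. It takes different
      values at \<open>D\<close> and \<open>D'\<close>, hence is true at one of them.\<close>
    have "separates (sym_diff B (A E)) x y \<longleftrightarrow> (separates B x y \<noteq> odd (card (E \<inter> ?J)))" for E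
      unfolding odd_card_Int_sym_diff[OF fin] separates_def
      using A_iff[OF i xy(1), of E] A_iff[OF i xy(2), of E] by blast
    then show "family_separates G x y"
      using D unfolding family_separates_def G_def by blast
  qed
  ultimately show ?thesis by blast
qed

section \<open>Tightness: sets that are trivial on some block\<close>

text \<open>Points of \<open>Y\<close> are told apart by which members of \<open>G\<close> contain
  them.\<close>

lemma card_le_if_separated:
  assumes "finite G" "\<And>x y. x \<in> Y \<Longrightarrow> y \<in> Y \<Longrightarrow> x \<noteq> y \<Longrightarrow> family_separates G x y"
  shows "card Y \<le> 2 ^ card G"
proof -
  have "inj_on (\<lambda>x. {A \<in> G. x \<in> A}) Y"
    using assms(2) unfolding family_separates_def separates_def by (intro inj_onI) blast
  then have "card Y \<le> card (Pow G)"
    using assms(1) by (intro card_inj_on_le) auto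
  then show ?thesis using assms(1) by (simp add: card_Pow)
qed

text \<open>With \<open>r = N - 2\<close>, Bernoulli gives
  \<open>(N / r) ^ N \<ge> 1 + 2 * N / r\<close>, which exceeds 2. For \<open>N = 2 ^ n\<close> this
  compares the sets nontrivial on all of \<open>N\<close> blocks with all sets.\<close>

lemma double_power_minus_two_less:
  assumes "(N::nat) > 2"
  shows "2 * (N - 2) ^ N < N ^ N"
proof -
  define r where "r = real (N - 2)"
  have r: "r > 0" "real N = r * (1 + 2 / r)" using assms by (auto simp: r_def field_simps of_nat_diff)
  have "2 < 1 + real N * (2 / r)" using r(1) r_def assms by (simp add: field_simps)
  also have "\<dots> \<le> (1 + 2 / r) ^ N" using divide_nonneg_pos[of 2 r] r by (intro Bernoulli_inequality) linarith
  finally have "r ^ N * 2 < r ^ N * (1 + 2 / r) ^ N" using r by simp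
  also have "\<dots> = real N ^ N" by (simp add: r(2) flip: power_mult_distrib)
  finally have "real (2 * (N - 2) ^ N) < real (N ^ N)" by (simp add: r_def mult.commute)
  then show ?thesis by (simp only: of_nat_less_iff)
qed

text \<open>A set is determined by its traces on the blocks, and each trace avoids two of the
  \<open>2 ^ n\<close> subsets, the empty one and the full one.\<close>

lemma card_nontrivial_on_blocks_le:
  assumes "finite I" and X: "\<And>i. i \<in> I \<Longrightarrow> finite (X i) \<and> card (X i) = n" and "n \<ge> 1"
  shows "card {A \<in> Pow (\<Union>i\<in>I. X i). \<forall>i\<in>I. A \<inter> X i \<noteq> {} \<and> \<not> X i \<subseteq> A} \<le> (2 ^ n - 2) ^ card I"
    (is "card ?C \<le> _")
proof -
  let ?P = "\<lambda>i. Pow (X i) - {{}, X i}"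
  have "inj_on (\<lambda>A. \<lambda>i\<in>I. A \<inter> X i) ?C"
  proof (rule inj_onI)
    fix A B assume AB: "A \<in> ?C" "B \<in> ?C" and eq: "(\<lambda>i\<in>I. A \<inter> X i) = (\<lambda>i\<in>I. B \<inter> X i)"
    have "A \<inter> X i = B \<inter> X i" if "i \<in> I" for i using fun_cong[OF eq, of i] that by simp
    then show "A = B" using AB by blast
  qed
  moreover have "(\<lambda>A. \<lambda>i\<in>I. A \<inter> X i) ` ?C \<subseteq> PiE I ?P"
    by (rule image_subsetI) (auto simp: PiE_iff simp flip: inf.absorb_iff2)
  ultimately have "card ?C \<le> card (PiE I ?P)"
    using assms by (intro card_inj_on_le) (auto intro: finite_PiE)
  also have "\<dots> = (\<Prod>i\<in>I. card (?P i))" by (rule card_PiE[OF assms(1)])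
  also have "\<dots> = (\<Prod>i\<in>I. 2 ^ n - 2)"
  proof (rule prod.cong[OF refl])
    fix i assume "i \<in> I"
    then have Xi: "finite (X i)" "card (X i) = n" using X by auto
    then have "X i \<noteq> {}" using \<open>n \<ge> 1\<close> by auto
    then have "card {{}, X i} = 2" by auto
    then show "card (?P i) = 2 ^ n - 2"
      using Xi by (subst card_Diff_subset) (auto simp: card_Pow)
  qed
  finally show ?thesis by simp
qed

text \<open>A set is nontrivial on one block with proportion \<open>1 - 2 / N\<close>, where
  \<open>N = 2 ^ n\<close>. Taking \<open>N\<close> blocks brings the proportion nontrivial on all
  of them below one half.\<close>

lemma more_than_half_trivial_on_some_block:
  fixes X :: "nat \<Rightarrow> 'a set"
  assumes disj: "disjoint_family_on X {1..2 ^ n}"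
    and X: "\<And>i. i \<in> {1..2 ^ n} \<Longrightarrow> finite (X i) \<and> card (X i) = n" and "n \<ge> (2::nat)"
  shows "more_than_half {A \<in> Pow (\<Union>i\<in>{1..2 ^ n}. X i). \<exists>i\<in>{1..2 ^ n}. A \<inter> X i = {} \<or> X i \<subseteq> A}
    (\<Union>i\<in>{1..2 ^ n}. X i)" (is "more_than_half ?F ?X")
proof -
  let ?N = "2 ^ n :: nat"
  let ?C = "{A \<in> Pow ?X. \<forall>i\<in>{1..?N}. A \<inter> X i \<noteq> {} \<and> \<not> X i \<subseteq> A}"
  have finX: "finite ?X" using X by blast
  have "card ?X = (\<Sum>i\<in>{1..?N}. card (X i))"
    using disj X by (intro card_UN_disjoint) (auto simp: disjoint_family_on_def)
  then have cardX: "2 ^ card ?X = ?N ^ ?N" using X by (simp add: mult.commute[of _ n] power_mult)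
  have "(2::nat) ^ 2 \<le> ?N" using \<open>n \<ge> 2\<close> by (intro power_increasing) auto
  then have "2 * (?N - 2) ^ ?N < 2 ^ card ?X"
    unfolding cardX by (intro double_power_minus_two_less) simp
  moreover have "card ?C \<le> (?N - 2) ^ ?N"
    using card_nontrivial_on_blocks_le[of "{1..?N}" X n] X \<open>n \<ge> 2\<close> by simp
  moreover have "card ?F + card ?C = 2 ^ card ?X"
  proof -
    have "card (?F \<union> ?C) = card ?F + card ?C" using finX by (intro card_Un_disjoint) auto
    moreover have "?F \<union> ?C = Pow ?X" by blast
    ultimately show ?thesis using finX by (simp add: card_Pow)
  qed
  moreover have "p < 2 * a" if "2 * b < p" "c \<le> b" "a + c = p" for a b c p :: nat
    using that by linarith
  ultimately show ?thesis unfolding more_than_half_iff by blast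
qed

text \<open>A member trivial on block \<open>i\<close> separates no pair there, so the other members
  already separate \<open>X i\<close>, and \<open>n \<le> 2 ^ (card G - 1)\<close>.\<close>

lemma log_card_bound_if_separates_within:
  assumes G: "finite G" "separates_within G k X" and k: "k \<ge> 1"
    and card: "\<And>i. i \<in> {1..k} \<Longrightarrow> card (X i) = n" and n: "n \<ge> 2"
    and triv: "\<And>A. A \<in> G \<Longrightarrow> \<exists>i\<in>{1..k}. A \<inter> X i = {} \<or> X i \<subseteq> A"
  shows "\<lceil>log 2 (real n)\<rceil> < int (card G)"
proof -
  have sep: "family_separates G x y" if "i \<in> {1..k}" "x \<in> X i" "y \<in> X i" "x \<noteq> y" for i x y
    using G that by (auto simp: separates_within_def)
  \<comment> \<open>A member to delete must exist: an empty family separates nothing, but a block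
    has at least two points.\<close>
  have "G \<noteq> {}"
  proof
    assume "G = {}"
    then have "card (X 1) \<le> 2 ^ card ({} :: 'a set set)"
      using sep[of 1] k by (intro card_le_if_separated) auto
    then show False using card[of 1] k n by simp
  qed
  then obtain g where g: "g \<in> G" by blast
  then obtain i where i: "i \<in> {1..k}" and gi: "g \<inter> X i = {} \<or> X i \<subseteq> g" using triv by blast
  have "card (X i) \<le> 2 ^ card (G - {g})"
  proof (rule card_le_if_separated)
    fix x y assume xy: "x \<in> X i" "y \<in> X i" "x \<noteq> y"
    then have "\<not> separates g x y" using gi by (auto simp: separates_def)
    then show "family_separates (G - {g}) x y"
      using sep[OF i xy] by (auto simp: family_separates_def)
  qed (use G in simp)
  then have "real n \<le> real (2 ^ card (G - {g}))" unfolding card[OF i] by (simp only: of_nat_le_iff)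
  then have "log 2 (real n) \<le> real (card (G - {g}))" using n by (simp add: log_le_iff powr_realpow)
  moreover have "card G = Suc (card (G - {g}))" by (rule card.remove[OF G(1) g])
  ultimately show ?thesis by linarith
qed

theorem theorem2:
  shows "(\<forall>(n::nat) (k::nat) (X :: nat \<Rightarrow> 'a set) (F :: 'a set set).
            n \<ge> 1 \<longrightarrow>
            disjoint_family_on X {1..k} \<longrightarrow>
            (\<forall>i\<in>{1..k}. finite (X i) \<and> card (X i) \<le> n) \<longrightarrow>
            F \<subseteq> Pow (\<Union>i\<in>{1..k}. X i) \<longrightarrow>
            more_than_half F (\<Union>i\<in>{1..k}. X i) \<longrightarrow>
            (\<exists>G\<subseteq>F. int (card G) \<le> \<lceil>log 2 (real n)\<rceil> + 1 \<and> separates_within G k X))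
       \<and> (\<forall>n::nat. n \<ge> 2 \<longrightarrow>
            (\<exists>(k::nat) (X :: nat \<Rightarrow> nat set) (F :: nat set set).
               disjoint_family_on X {1..k} \<and>
               (\<forall>i\<in>{1..k}. finite (X i) \<and> card (X i) \<le> n) \<and>
               F \<subseteq> Pow (\<Union>i\<in>{1..k}. X i) \<and>
               more_than_half F (\<Union>i\<in>{1..k}. X i) \<and>
               \<not> (\<exists>G\<subseteq>F. int (card G) \<le> \<lceil>log 2 (real n)\<rceil> \<and> separates_within G k X)))"
proof (intro conjI allI impI)
  fix n k :: nat and X :: "nat \<Rightarrow> 'a set" and F :: "'a set set"
  assume n: "n \<ge> 1" and disj: "disjoint_family_on X {1..k}"
    and X: "\<forall>i\<in>{1..k}. finite (X i) \<and> card (X i) \<le> n"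
    and F: "F \<subseteq> Pow (\<Union>i\<in>{1..k}. X i)" "more_than_half F (\<Union>i\<in>{1..k}. X i)"
  define m where "m = nat \<lceil>log 2 (real n)\<rceil>"
  \<comment> \<open>Nonnegativity ensures that \<open>nat\<close> does not truncate the
    ceiling.\<close>
  have "0 \<le> log 2 (real n)" using n by simp
  then have m: "int m = \<lceil>log 2 (real n)\<rceil>" unfolding m_def by linarith
  then have "log 2 (real n) \<le> real m" by linarith
  then have "real n \<le> real (2 ^ m)" using n by (simp add: log_le_iff powr_realpow)
  then have "n \<le> 2 ^ m" by (simp only: of_nat_le_iff)
  then have "\<forall>i\<in>{1..k}. finite (X i) \<and> card (X i) \<le> 2 ^ m" using X by fastforce
  from separating_subfamily_exists[OF disj this F] obtain G
    where "G \<subseteq> F" "card G \<le> m + 1" "separates_within G k X" by blast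
  then show "\<exists>G\<subseteq>F. int (card G) \<le> \<lceil>log 2 (real n)\<rceil> + 1 \<and> separates_within G k X"
    by (intro exI[of _ G]) (simp flip: m)
next
  fix n :: nat assume n: "n \<ge> 2"
  define k where "k = (2::nat) ^ n"
  define X where "X i = {i * n..<Suc i * n}" for i :: nat
  let ?X = "\<Union>i\<in>{1..k}. X i"
  define F where "F = {A \<in> Pow ?X. \<exists>i\<in>{1..k}. A \<inter> X i = {} \<or> X i \<subseteq> A}"
  have X: "finite (X i) \<and> card (X i) = n" for i by (simp add: X_def)
  \<comment> \<open>The blocks are consecutive intervals of length \<open>n\<close>, so division
    recovers the index and gives disjointness.\<close>
  have "x div n = i" if "x \<in> X i" for x i
    using that n by (intro div_nat_eqI) (auto simp: X_def mult.commute)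
  then have disj: "disjoint_family_on X {1..k}"
    unfolding disjoint_family_on_def by blast
  have "more_than_half F ?X"
    unfolding F_def k_def
    by (rule more_than_half_trivial_on_some_block) (use disj X n in \<open>auto simp: k_def\<close>)
  moreover have "\<not> (\<exists>G\<subseteq>F. int (card G) \<le> \<lceil>log 2 (real n)\<rceil> \<and> separates_within G k X)"
  proof
    assume "\<exists>G\<subseteq>F. int (card G) \<le> \<lceil>log 2 (real n)\<rceil> \<and> separates_within G k X"
    then obtain G where G: "G \<subseteq> F" "int (card G) \<le> \<lceil>log 2 (real n)\<rceil>" "separates_within G k X" by blast
    \<comment> \<open>Finiteness of \<open>G\<close> must come from the ground set:
      \<open>card\<close> is 0 on infinite sets, so the cardinality bound does not imply it.\<close>
    have "finite ?X" using X by blast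
    then have "finite G" using G(1) by (auto simp: F_def intro: finite_subset)
    moreover have "k \<ge> 1" by (simp add: k_def)
    ultimately have "\<lceil>log 2 (real n)\<rceil> < int (card G)"
      using G X n by (intro log_card_bound_if_separates_within[of G k X]) (auto simp: F_def)
    with G show False by linarith
  qed
  moreover have "F \<subseteq> Pow ?X" by (auto simp: F_def)
  ultimately show "\<exists>(k::nat) (X :: nat \<Rightarrow> nat set) (F :: nat set set).
      disjoint_family_on X {1..k} \<and>
      (\<forall>i\<in>{1..k}. finite (X i) \<and> card (X i) \<le> n) \<and>
      F \<subseteq> Pow (\<Union>i\<in>{1..k}. X i) \<and>
      more_than_half F (\<Union>i\<in>{1..k}. X i) \<and>
      \<not> (\<exists>G\<subseteq>F. int (card G) \<le> \<lceil>log 2 (real n)\<rceil> \<and> separates_within G k X)"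
    using disj X by (intro exI[of _ k] exI[of _ X] exI[of _ F] conjI ballI) simp_all
qed

end
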